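(* Let $\sigma\subseteq\tau$ be topologies on a set $X$. Assume that $\tau$ is regular, Baire, and has a neighborhood basis consisting of sets that have the Baire property with respect to $\sigma$. If $\sigma=(\sigma,\tau)$, then $\sigma=\tau$.
   Context: A topology is Baire if every countable union of nowhere dense sets has dense complement. A neighborhood of $x$ (w.r.t. $\tau$) is any set containing $x$ in its $\tau$-interior; a neighborhood basis of $\tau$ is a family $\mathcal A$ of subsets of $X$ such that for each $x\in X$ and each neighborhood $B$ of $x$ there is $A\in\mathcal A$ which is a neighborhood of $x$ with $A\subseteq B$ (sets in $\mathcal A$ need not be open). $(\sigma,\tau)$ denotes the topology consisting of all unions of sets $U\cap{\rm int}_\tau(F)$ with $U$ $\sigma$-open and $F$ $\sigma$-closed. *)

theory Defs
  imports "HOL-Analysis.Analysis"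
begin

definition nowhere_dense_in :: "'a topology \<Rightarrow> 'a set \<Rightarrow> bool" where
  "nowhere_dense_in X N \<longleftrightarrow>
     N \<subseteq> topspace X \<and> X interior_of (X closure_of N) = {}"

definition meager_in :: "'a topology \<Rightarrow> 'a set \<Rightarrow> bool" where
  "meager_in X = countable union_of nowhere_dense_in X"

definition baire_topology :: "'a topology \<Rightarrow> bool" where
  "baire_topology X \<longleftrightarrow>
     (\<forall>M. meager_in X M \<longrightarrow> X closure_of (topspace X - M) = topspace X)"

definition baire_property_in :: "'a topology \<Rightarrow> 'a set \<Rightarrow> bool" where
  "baire_property_in X A \<longleftrightarrow> (\<exists>U. openin X U \<and> meager_in X (sym_diff A U))"

(* The library's neighbourhood_base_of ranges over open W only; the two lemmas below show
   that this agrees with the formulation over arbitrary neighbourhoods B, and that sets with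
   the Baire property lie in the underlying set. *)
lemma neighbourhood_base_of_iff_neighbourhoods:
  "neighbourhood_base_of (\<lambda>A. A \<in> \<A>) X \<longleftrightarrow>
     (\<forall>x \<in> topspace X. \<forall>B. x \<in> X interior_of B \<longrightarrow>
        (\<exists>A \<in> \<A>. x \<in> X interior_of A \<and> A \<subseteq> B))"
  (is "?L \<longleftrightarrow> ?R")
proof
  assume L: ?L
  show ?R
  proof (intro ballI allI impI)
    fix x B assume "x \<in> X interior_of B"
    then obtain U V where "openin X U" "V \<in> \<A>" "x \<in> U" "U \<subseteq> V" "V \<subseteq> X interior_of B"
      using L unfolding neighbourhood_base_of by (metis openin_interior_of)
    then show "\<exists>A \<in> \<A>. x \<in> X interior_of A \<and> A \<subseteq> B"
      by (meson interior_of_maximal interior_of_subset subset_trans subsetD)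
  qed
next
  assume R: ?R
  show ?L
    unfolding neighbourhood_base_of
  proof (intro allI impI, elim conjE)
    fix W x assume "openin X W" "x \<in> W"
    then have "x \<in> topspace X" "x \<in> X interior_of W"
      using openin_subset by (auto simp: interior_of_openin)
    with R obtain A where "A \<in> \<A>" "x \<in> X interior_of A" "A \<subseteq> W"
      by blast
    then show "\<exists>U V. openin X U \<and> V \<in> \<A> \<and> x \<in> U \<and> U \<subseteq> V \<and> V \<subseteq> W"
      by (meson interior_of_subset openin_interior_of)
  qed
qed

lemma baire_property_in_subset:
  assumes "baire_property_in X A"
  shows "A \<subseteq> topspace X"
proof -
  obtain U where U: "openin X U" "meager_in X (sym_diff A U)"
    using assms unfolding baire_property_in_def by blast
  then have "sym_diff A U \<subseteq> topspace X"
    unfolding meager_in_def union_of_def nowhere_dense_in_def by blast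
  then show ?thesis
    using openin_subset[OF U(1)] by blast
qed

definition pair_topology :: "'a topology \<Rightarrow> 'a topology \<Rightarrow> 'a topology" where
  "pair_topology \<sigma> \<tau> =
     topology (arbitrary union_of (\<lambda>S. \<exists>U F. openin \<sigma> U \<and> closedin \<sigma> F \<and> S = U \<inter> \<tau> interior_of F))"

(* The function topology is only meaningful on families that are topologies, which this one is. *)
lemma openin_pair_topology:
  "openin (pair_topology \<sigma> \<tau>) =
     arbitrary union_of (\<lambda>S. \<exists>U F. openin \<sigma> U \<and> closedin \<sigma> F \<and> S = U \<inter> \<tau> interior_of F)"
proof -
  have "istopology (arbitrary union_of
     (\<lambda>S. \<exists>U F. openin \<sigma> U \<and> closedin \<sigma> F \<and> S = U \<inter> \<tau> interior_of F))"
  proof (rule istopology_base, elim exE conjE)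
    fix S T U F V G
    assume "openin \<sigma> U" "closedin \<sigma> F" "S = U \<inter> \<tau> interior_of F"
      and "openin \<sigma> V" "closedin \<sigma> G" "T = V \<inter> \<tau> interior_of G"
    then have "openin \<sigma> (U \<inter> V)" "closedin \<sigma> (F \<inter> G)"
      "S \<inter> T = (U \<inter> V) \<inter> \<tau> interior_of (F \<inter> G)"
      by (auto simp: interior_of_Int)
    then show "\<exists>U F. openin \<sigma> U \<and> closedin \<sigma> F \<and> S \<inter> T = U \<inter> \<tau> interior_of F"
      by blast
  qed
  then show ?thesis
    unfolding pair_topology_def by (rule topology_inverse')
qed

end

theory Submission
  imports Defs
begin

text \<open>
  If \<open>\<sigma> = (\<sigma>, \<tau>)\<close>, then \<open>\<sigma>\<close> and \<open>\<tau>\<close> assign the same interior to each \<open>\<sigma>\<close>-closed set and the same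
  closure to each \<open>\<sigma>\<close>-open set; in particular \<open>\<sigma>\<close>-meager sets are \<open>\<tau>\<close>-meager. Let \<open>A\<close> differ from
  a \<open>\<sigma>\<close>-open set \<open>U\<close> by a \<open>\<sigma>\<close>-meager set. As \<open>\<tau>\<close> is Baire, this difference has empty
  \<open>\<tau>\<close>-interior, which gives \<open>int\<^sub>\<tau> A \<subseteq> cl\<^sub>\<tau> U \<subseteq> cl\<^sub>\<tau> A\<close>. So the \<open>\<tau>\<close>-interior of \<open>cl\<^sub>\<sigma> U = cl\<^sub>\<tau> U\<close> is
  a \<open>\<sigma>\<close>-open set between \<open>int\<^sub>\<tau> A\<close> and \<open>cl\<^sub>\<tau> A\<close>. Regularity makes such \<open>A\<close> arbitrarily small
  together with their \<open>\<tau>\<close>-closures, hence every \<open>\<tau>\<close>-open set is \<open>\<sigma>\<close>-open.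
\<close>

lemma interior_of_openin_Diff:
  assumes "openin X V"
  shows "X interior_of (V - S) = V - X closure_of S"
proof -
  have "V - S = V \<inter> (topspace X - S)"
    using openin_subset[OF assms] by blast
  then have "X interior_of (V - S) = V \<inter> (topspace X - X closure_of S)"
    by (simp only: interior_of_Int interior_of_openin[OF assms] interior_of_complement)
  then show ?thesis
    using openin_subset[OF assms] by blast
qed

lemma interior_of_subset_closure_of_sym_diff:
  assumes "X interior_of (sym_diff A U) = {}"
  shows "X interior_of A \<subseteq> X closure_of U"
proof -
  have "X interior_of (X interior_of A - U) \<subseteq> X interior_of (sym_diff A U)"
    using interior_of_subset[of X A] by (intro interior_of_mono) blast
  with assms show ?thesis
    by (simp add: interior_of_openin_Diff)
qed

lemma closure_of_subset_closure_of_sym_diff: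
  assumes "openin X U" and "X interior_of (sym_diff A U) = {}"
  shows "X closure_of U \<subseteq> X closure_of A"
proof (rule closure_of_minimal)
  have "X interior_of (U - A) \<subseteq> X interior_of (sym_diff A U)"
    by (intro interior_of_mono) blast
  with assms show "U \<subseteq> X closure_of A"
    by (simp add: interior_of_openin_Diff)
qed simp

lemma baire_topology_iff_interior_of_meager_in:
  "baire_topology X \<longleftrightarrow> (\<forall>M. meager_in X M \<longrightarrow> X interior_of M = {})"
  by (simp add: baire_topology_def interior_of_eq_empty_complement)

lemma regular_space_neighbourhood_base_closure_of:
  assumes "regular_space X" and base: "neighbourhood_base_of P X"
    and "openin X W" and "x \<in> W"
  obtains A where "P A" and "x \<in> X interior_of A" and "X closure_of A \<subseteq> W"
proof -
  have "neighbourhood_base_of (closedin X) X"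
    using assms(1) by (simp add: neighbourhood_base_of_closedin)
  with assms(3,4) obtain V C
    where V: "openin X V" "x \<in> V" "V \<subseteq> C" and C: "closedin X C" "C \<subseteq> W"
    unfolding neighbourhood_base_of by meson
  from base V(1,2) obtain T A where A: "openin X T" "P A" "x \<in> T" "T \<subseteq> A" "A \<subseteq> V"
    unfolding neighbourhood_base_of by meson
  show thesis
  proof
    show "P A"
      by fact
    show "x \<in> X interior_of A"
      using A(1,3,4) interior_of_maximal by blast
    have "X closure_of A \<subseteq> C"
      using A(5) V(3) C(1) by (intro closure_of_minimal) auto
    with C(2) show "X closure_of A \<subseteq> W"
      by blast
  qed
qed

locale finer_topology =
  fixes \<sigma> \<tau> :: "'a topology"
  assumes topspace_eq: "topspace \<tau> = topspace \<sigma>"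
    and openin_finer: "openin \<sigma> U \<Longrightarrow> openin \<tau> U"
begin

lemma interior_of_subset_finer: "\<sigma> interior_of S \<subseteq> \<tau> interior_of S"
  by (intro interior_of_maximal interior_of_subset openin_finer openin_interior_of)

lemma closure_of_finer_subset: "\<tau> closure_of S \<subseteq> \<sigma> closure_of S"
  unfolding closure_of_interior_of topspace_eq using interior_of_subset_finer by blast

end

locale pair_stable_topology = finer_topology +
  assumes pair_topology_eq: "pair_topology \<sigma> \<tau> = \<sigma>"
begin

lemma openin_interior_of_closedin:
  assumes "closedin \<sigma> F"
  shows "openin \<sigma> (\<tau> interior_of F)"
proof -
  have "\<tau> interior_of F = topspace \<sigma> \<inter> \<tau> interior_of F"
    using interior_of_subset_topspace[of \<tau> F] topspace_eq by blast
  with assms have "openin (pair_topology \<sigma> \<tau>) (\<tau> interior_of F)"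
    unfolding openin_pair_topology by (intro arbitrary_union_of_inc) blast
  then show ?thesis
    by (simp only: pair_topology_eq)
qed

lemma interior_of_closedin_eq:
  assumes "closedin \<sigma> F"
  shows "\<tau> interior_of F = \<sigma> interior_of F"
  using interior_of_maximal[OF interior_of_subset openin_interior_of_closedin[OF assms]]
    interior_of_subset_finer
  by blast

lemma closure_of_openin_eq:
  assumes "openin \<sigma> U"
  shows "\<tau> closure_of U = \<sigma> closure_of U"
proof -
  have "closedin \<sigma> (topspace \<sigma> - U)"
    using assms by blast
  then show ?thesis
    by (simp only: closure_of_interior_of topspace_eq interior_of_closedin_eq)
qed

lemma nowhere_dense_in_finer:
  assumes "nowhere_dense_in \<sigma> N"
  shows "nowhere_dense_in \<tau> N"
proof -
  have "\<tau> interior_of (\<tau> closure_of N) \<subseteq> \<tau> interior_of (\<sigma> closure_of N)"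
    by (intro interior_of_mono closure_of_finer_subset)
  also have "\<dots> = \<sigma> interior_of (\<sigma> closure_of N)"
    by (simp add: interior_of_closedin_eq)
  finally show ?thesis
    using assms topspace_eq by (simp add: nowhere_dense_in_def)
qed

lemma meager_in_finer: "meager_in \<sigma> M \<Longrightarrow> meager_in \<tau> M"
  unfolding meager_in_def by (erule union_of_mono) (rule nowhere_dense_in_finer)

lemma baire_property_in_openin_between:
  assumes "baire_topology \<tau>" and "baire_property_in \<sigma> A"
  obtains V where "openin \<sigma> V" and "\<tau> interior_of A \<subseteq> V" and "V \<subseteq> \<tau> closure_of A"
proof -
  obtain U where U: "openin \<sigma> U" and meager: "meager_in \<sigma> (sym_diff A U)"
    using assms(2) unfolding baire_property_in_def by blast
  have empty: "\<tau> interior_of (sym_diff A U) = {}"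
    using assms(1) meager_in_finer[OF meager] by (simp add: baire_topology_iff_interior_of_meager_in)
  note closure_eq = closure_of_openin_eq[OF U]
  show thesis
  proof
    show "openin \<sigma> (\<tau> interior_of (\<sigma> closure_of U))"
      by (simp add: openin_interior_of_closedin)
    show "\<tau> interior_of A \<subseteq> \<tau> interior_of (\<sigma> closure_of U)"
      using interior_of_subset_closure_of_sym_diff[OF empty]
      by (simp add: interior_of_maximal closure_eq)
    show "\<tau> interior_of (\<sigma> closure_of U) \<subseteq> \<tau> closure_of A"
      using closure_of_subset_closure_of_sym_diff[OF openin_finer[OF U] empty]
        interior_of_subset[of \<tau> "\<sigma> closure_of U"]
      unfolding closure_eq by blast
  qed
qed

end

theorem theorem3p1:
  fixes X :: "'a set" and \<sigma> \<tau> :: "'a topology"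
  assumes "topspace \<sigma> = X" and "topspace \<tau> = X"
    and "\<forall>U. openin \<sigma> U \<longrightarrow> openin \<tau> U"
    and "regular_space \<tau>"
    and "baire_topology \<tau>"
    and "\<exists>\<A>. neighbourhood_base_of (\<lambda>A. A \<in> \<A>) \<tau> \<and> (\<forall>A \<in> \<A>. baire_property_in \<sigma> A)"
    and "\<sigma> = pair_topology \<sigma> \<tau>"
  shows "\<sigma> = \<tau>"
proof -
  interpret pair_stable_topology \<sigma> \<tau>
    using assms(1-3) assms(7)[symmetric] by unfold_locales auto
  have base: "neighbourhood_base_of (baire_property_in \<sigma>) \<tau>"
    using assms(6) by (blast intro: neighbourhood_base_of_mono)
  have "openin \<sigma> W" if "openin \<tau> W" for W
  proof (subst openin_subopen, intro ballI)
    fix x assume "x \<in> W"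
    obtain A where A: "baire_property_in \<sigma> A" "x \<in> \<tau> interior_of A" "\<tau> closure_of A \<subseteq> W"
      using regular_space_neighbourhood_base_closure_of[OF assms(4) base \<open>openin \<tau> W\<close> \<open>x \<in> W\<close>] .
    obtain V where "openin \<sigma> V" "\<tau> interior_of A \<subseteq> V" "V \<subseteq> \<tau> closure_of A"
      using baire_property_in_openin_between[OF assms(5) A(1)] .
    with A(2,3) show "\<exists>V. openin \<sigma> V \<and> x \<in> V \<and> V \<subseteq> W"
      by blast
  qed
  then show ?thesis
    using openin_finer by (auto simp: topology_eq)
qed

end
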